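(* Let $d$ be a positive integer. There exists a $(d+1)\times(d+1)$ matrix $\mathcal{B}_d$ over $\mathbb{Z}$, with rows and columns indexed by $0,1,\ldots,d$, such that the following holds. Let $f(q)=\sum_{n=0}^{\infty}\nu_nq^n$ be a homogeneous polynomial in $a(q)$ and $b(q)$, $$f(q)=\sum_{n=0}^{d}\alpha_n\,a^{d-n}(q)\,b^{n}(q),\qquad \alpha_n\in\mathbb{C}.$$ If $$\mathcal{B}_d(\alpha_0,\alpha_1,\ldots,\alpha_d)^T=(\beta_0,\beta_1,\ldots,\beta_d)^T,$$ then $$\pi(f)=f(q^{1/3})=\sum_{n=0}^{d}\beta_n\,a^{n}(q)\,c^{d-n}(q).$$ Moreover, the $(r,n)$th entry of $\mathcal{B}_d$ equals $$2^{d-n}(-1)^{n-r}\binom{n}{r}\,{}_2F_1\!\left(n-d,-r;\,n-r+1;\,-\tfrac12\right),$$ where this expression is understood as the finite sum $$\sum_{k=0}^{d-n}2^{(d-n)-k}(-1)^{n-(r-k)}\binom{d-n}{k}\binom{n}{r-k}$$ (the two agree literally when $r\le n$; when $r>n$ the finite sum gives the meaning of the expression).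
   Context: Let $q=e^{2\pi i\tau}$ with $\operatorname{Im}\tau>0$, and $q^{s}=e^{2\pi i s\tau}$ for rational $s$. The Borweins' cubic theta functions are $$a(q)=\sum_{m,n=-\infty}^{\infty}q^{n^2+nm+m^2},\qquad b(q)=\sum_{m,n=-\infty}^{\infty}\omega^{n-m}q^{n^2+nm+m^2},$$ $$c(q)=\sum_{m,n=-\infty}^{\infty} q^{(n+\frac13)^2+(n+\frac13)(m+\frac13)+(m+\frac13)^2},\qquad \omega=e^{2\pi i/3}.$$ The operator $\pi$ is $\pi\bigl(\sum_{n\ge0}\nu_nq^n\bigr)=\sum_{n\ge0}\nu_nq^{n/3}$. ${}_2F_1(A,B;C;z)=\sum_{k\ge0}\frac{(A)_k(B)_k}{(C)_k\,k!}z^k$ is the Gauss hypergeometric function, with $(A)_k=A(A+1)\cdots(A+k-1)$. Binomial coefficients $\binom{N}{i}$ are $0$ when $i<0$ or $i>N$. *)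

theory Defs
  imports Complex_Main "HOL-Analysis.Infinite_Sum" "Jordan_Normal_Form.Matrix"
begin

text \<open>
  All functions of $q = e^{2\pi i\tau}$ are treated as functions of $\tau$ in the upper half-plane,
  so that the fractional powers $q^s = e^{2\pi i s\tau}$ are unambiguous; in particular
  $f(q^{1/3})$ is the value of $f$ at $\tau/3$.
\<close>

definition qpow :: "complex \<Rightarrow> real \<Rightarrow> complex" where
  "qpow \<tau> s = exp (2 * of_real pi * \<i> * of_real s * \<tau>)"

definition omega :: complex where
  "omega = exp (2 * of_real pi * \<i> / 3)"

definition cubic_a :: "complex \<Rightarrow> complex" where
  "cubic_a \<tau> = (\<Sum>\<^sub>\<infinity>(m, n)\<in>(UNIV :: (int \<times> int) set). qpow \<tau> (of_int (n^2 + n * m + m^2)))"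

definition cubic_b :: "complex \<Rightarrow> complex" where
  "cubic_b \<tau> = (\<Sum>\<^sub>\<infinity>(m, n)\<in>(UNIV :: (int \<times> int) set).
     omega powi (n - m) * qpow \<tau> (of_int (n^2 + n * m + m^2)))"

definition cubic_c :: "complex \<Rightarrow> complex" where
  "cubic_c \<tau> = (\<Sum>\<^sub>\<infinity>(m, n)\<in>(UNIV :: (int \<times> int) set).
     qpow \<tau> ((of_int n + 1/3)^2 + (of_int n + 1/3) * (of_int m + 1/3) + (of_int m + 1/3)^2))"

definition has_q_expansion :: "(complex \<Rightarrow> complex) \<Rightarrow> (nat \<Rightarrow> complex) \<Rightarrow> bool" where
  "has_q_expansion f \<nu> \<longleftrightarrow> (\<forall>\<tau>. Im \<tau> > 0 \<longrightarrow> (\<lambda>n. \<nu> n * qpow \<tau> (of_nat n)) sums f \<tau>)"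

text \<open>The operator $\pi$, acting on a $q$-series given by its coefficient sequence.\<close>

definition pi_op :: "(nat \<Rightarrow> complex) \<Rightarrow> complex \<Rightarrow> complex" where
  "pi_op \<nu> \<tau> = (\<Sum>n. \<nu> n * qpow \<tau> (of_nat n / 3))"

definition hyp2F1 :: "complex \<Rightarrow> complex \<Rightarrow> complex \<Rightarrow> complex \<Rightarrow> complex" where
  "hyp2F1 A B C z = (\<Sum>k. pochhammer A k * pochhammer B k / (pochhammer C k * fact k) * z ^ k)"

text \<open>The lower index may be negative, in which case the coefficient vanishes; truncated
  subtraction on \<^typ>\<open>nat\<close> would give $1$ instead.\<close>

definition binom :: "nat \<Rightarrow> int \<Rightarrow> nat" where
  "binom N i = (if 0 \<le> i \<and> i \<le> int N then N choose nat i else 0)"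

end

theory Submission imports Defs
begin

text \<open>
  The exponent \<open>n\<^sup>2 + n m + m\<^sup>2\<close> is the norm on the Eisenstein lattice, and \<open>3\<close> is the norm of the
  prime \<open>\<theta> = 1 - \<omega>\<close>.  Replacing \<open>\<tau>\<close> by \<open>\<tau>/3\<close> divides the exponents by \<open>3\<close>, which on the
  sublattice \<open>\<theta>\<Lambda>\<close> is undone by dividing its points by \<open>\<theta>\<close>.  On \<open>\<theta>\<Lambda>\<close> the series of \<open>a\<close>
  at \<open>\<tau>/3\<close> therefore sums to \<open>a(\<tau>)\<close>.  On each of the other two cosets, which are negatives of each
  other, it is the same series with the lattice translated by a third of a lattice vector, namely
  \<open>c(\<tau>)\<close>.  Since \<open>n - m\<close> modulo \<open>3\<close> labels the cosets, the weights \<open>\<omega>\<^sup>n\<^sup>-\<^sup>m\<close> of \<open>b\<close> are constant on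
  them, with values \<open>1\<close>, \<open>\<omega>\<close> and \<open>\<omega>\<^sup>-\<^sup>1\<close>.  As \<open>\<omega> + \<omega>\<^sup>-\<^sup>1 = - 1\<close>, this gives
  (\<open>cubic_a_third\<close>, \<open>cubic_b_third\<close>)
    \<open>a(\<tau>/3) = a(\<tau>) + 2 c(\<tau>)\<close>  and  \<open>b(\<tau>/3) = a(\<tau>) - c(\<tau>)\<close>.

  So \<open>\<pi>\<close> maps \<open>a\<^sup>d\<^sup>-\<^sup>n b\<^sup>n\<close> to \<open>(a + 2c)\<^sup>d\<^sup>-\<^sup>n (a - c)\<^sup>n\<close>, and the \<open>n\<close>th column of the matrix lists the
  coefficients of this binary form.  Multiplying out the two binomial expansions gives the double
  binomial sum (\<open>subst_coeff_expansion\<close>); for \<open>r \<le> n\<close>, dividing it by its term at \<open>k = 0\<close> turns it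
  term by term into a terminating hypergeometric series (\<open>subst_coeff_eq_hyp2F1\<close>).

  That \<open>f\<close> has a power series in \<open>q\<close> at all follows by collecting the lattice points of equal norm
  in \<open>a\<close> and \<open>b\<close> and multiplying the resulting absolutely convergent series.  Any such expansion,
  evaluated at \<open>\<tau>/3\<close>, is literally the series that defines \<open>\<pi>(f)\<close> at \<open>\<tau>\<close>, whence
  \<open>\<pi>(f) = f(q\<^sup>1\<^sup>/\<^sup>3)\<close>.
\<close>

section \<open>The norm form and summability\<close>

abbreviation norm_form :: "int \<Rightarrow> int \<Rightarrow> int" where
  "norm_form m n \<equiv> n\<^sup>2 + n * m + m\<^sup>2"

text \<open>Definiteness of the form comes from
  \<open>2 (n\<^sup>2 + n m + m\<^sup>2) = (m + n)\<^sup>2 + m\<^sup>2 + n\<^sup>2\<close>.  Weakening the squares to absolute values makes the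
  bound linear, so that theta series are dominated by a product of two geometric series.\<close>

lemma norm_form_lower_bound: "\<bar>m\<bar> + \<bar>n\<bar> \<le> 2 * norm_form m n"
proof -
  have abs_le_sq: "\<bar>x\<bar> \<le> x\<^sup>2" for x :: int
    using self_le_power[of "\<bar>x\<bar>" 2] by (cases "x = 0") simp_all
  have "m\<^sup>2 + n\<^sup>2 \<le> 2 * norm_form m n"
    using zero_le_power2[of "m + n"] by (simp add: power2_sum algebra_simps)
  with abs_le_sq[of m] abs_le_sq[of n] show ?thesis by linarith
qed

lemma norm_form_nonneg: "0 \<le> norm_form m n"
proof -
  have "0 \<le> 2 * norm_form m n"
    by (rule order_trans[OF _ norm_form_lower_bound]) simp
  then show ?thesis unfolding zero_le_mult_iff by simp
qed

lemma qpow_add: "qpow \<tau> (s + t) = qpow \<tau> s * qpow \<tau> t"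
  unfolding qpow_def by (simp add: algebra_simps flip: exp_add)

lemma qpow_scale: "qpow (\<tau> / 3) s = qpow \<tau> (s / 3)"
  unfolding qpow_def by simp

lemma qpow_of_nat: "qpow \<tau> (of_nat n) = qpow \<tau> 1 ^ n"
  unfolding qpow_def by (simp add: algebra_simps flip: exp_of_nat_mult)

lemma norm_qpow: "norm (qpow \<tau> s) = exp (- (2 * pi * s * Im \<tau>))"
  unfolding qpow_def by (simp add: norm_exp_eq_Re)

lemma summable_on_power_abs_int:
  fixes r :: real
  assumes "0 \<le> r" "r < 1"
  shows "(\<lambda>m::int. r ^ nat \<bar>m\<bar>) summable_on UNIV"
proof -
  have geo: "(\<lambda>n::nat. r ^ n) summable_on UNIV"
    using assms by (subst summable_on_UNIV_nonneg_real_iff) (auto intro: summable_geometric)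
  have "(\<lambda>m::int. r ^ nat \<bar>m\<bar>) summable_on range int"
    using geo by (subst summable_on_reindex) (auto simp: o_def)
  moreover have "(\<lambda>m::int. r ^ nat \<bar>m\<bar>) summable_on range (\<lambda>n. - int n)"
    using geo by (subst summable_on_reindex) (auto simp: o_def inj_on_def)
  ultimately have "(\<lambda>m::int. r ^ nat \<bar>m\<bar>) summable_on (range int \<union> range (\<lambda>n. - int n))"
    by (rule summable_on_union)
  moreover have "range int \<union> range (\<lambda>n. - int n) = UNIV"
    by (auto intro: int_cases2)
  ultimately show ?thesis by simp
qed

lemma summable_on_power_abs_int_prod:
  fixes r :: real
  assumes "0 \<le> r" "r < 1"
  shows "(\<lambda>(m::int, n::int). r ^ nat \<bar>m\<bar> * r ^ nat \<bar>n\<bar>) summable_on UNIV"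
proof -
  let ?g = "\<lambda>m::int. r ^ nat \<bar>m\<bar>"
  have s: "?g summable_on UNIV"
    by (rule summable_on_power_abs_int[OF assms])
  have "(\<lambda>(m, n). ?g m * ?g n) summable_on (Sigma UNIV (\<lambda>_. UNIV))"
  proof (rule summable_on_SigmaI)
    fix m :: int
    show "((\<lambda>n. case (m, n) of (m, n) \<Rightarrow> ?g m * ?g n) has_sum ?g m * infsum ?g UNIV) UNIV"
      using has_sum_cmult_right[OF has_sum_infsum[OF s], of "?g m"] by simp
  qed (use assms s in \<open>auto intro!: summable_on_cmult_left\<close>)
  then show ?thesis by simp
qed

text \<open>One statement serves both \<open>a\<close> (weight \<open>1\<close>) and \<open>b\<close> (weights cube roots of unity).\<close>

lemma theta_summable:
  fixes w :: "int \<times> int \<Rightarrow> complex"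
  assumes "Im \<tau> > 0" and w: "\<And>p. norm (w p) \<le> 1"
  shows "(\<lambda>(m, n). w (m, n) * qpow \<tau> (of_int (norm_form m n))) summable_on UNIV"
proof -
  define r where "r = exp (- (pi * Im \<tau>))"
  have r: "0 \<le> r" "r < 1" using assms(1) by (auto simp: r_def)
  have bound: "norm (w (m, n) * qpow \<tau> (of_int (norm_form m n))) \<le> r ^ nat \<bar>m\<bar> * r ^ nat \<bar>n\<bar>" for m n
  proof -
    have "real_of_int (\<bar>m\<bar> + \<bar>n\<bar>) \<le> real_of_int (2 * norm_form m n)"
      using norm_form_lower_bound[of m n] by (simp only: of_int_le_iff)
    then have "(pi * Im \<tau>) * real_of_int (\<bar>m\<bar> + \<bar>n\<bar>) \<le> (pi * Im \<tau>) * real_of_int (2 * norm_form m n)"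
      using assms(1) by (intro mult_left_mono) auto
    then have "norm (qpow \<tau> (of_int (norm_form m n))) \<le> exp (- (pi * Im \<tau>) * real_of_int (\<bar>m\<bar> + \<bar>n\<bar>))"
      unfolding norm_qpow exp_le_cancel_iff by (simp add: algebra_simps)
    also have "\<dots> = r ^ nat \<bar>m\<bar> * r ^ nat \<bar>n\<bar>"
      unfolding r_def by (simp add: algebra_simps flip: exp_of_nat_mult exp_add)
    finally have "norm (qpow \<tau> (of_int (norm_form m n))) \<le> r ^ nat \<bar>m\<bar> * r ^ nat \<bar>n\<bar>" .
    with mult_mono[OF w[of "(m, n)"] this] show ?thesis
      by (simp add: norm_mult)
  qed
  have "(\<lambda>p. norm (case p of (m, n) \<Rightarrow> w (m, n) * qpow \<tau> (of_int (norm_form m n)))) summable_on UNIV"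
    by (rule abs_summable_on_comparison_test'[OF summable_on_power_abs_int_prod[OF r]])
       (use bound in auto)
  then show ?thesis by (rule abs_summable_summable)
qed

section \<open>The cubic transformation of the theta functions\<close>

lemma omega_cube: "omega ^ 3 = 1"
  using exp_two_pi_i unfolding omega_def by (simp add: mult_ac flip: exp_of_nat_mult)

lemma norm_omega: "norm omega = 1"
  unfolding omega_def by (simp add: norm_exp_eq_Re)

lemma omega_nonzero: "omega \<noteq> 0"
  by (simp add: omega_def)

lemma omega_sum: "omega + inverse omega = - 1"
proof -
  have Re: "Re omega = - 1 / 2"
    unfolding omega_def by (simp add: Re_exp cos_120)
  have "inverse omega = cnj omega"
    using norm_omega omega_nonzero by (simp add: inverse_unique complex_norm_square[symmetric] field_simps)
  then show ?thesis using Re by (simp add: complex_eq_iff)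
qed

lemma omega_powi_add_multiple: "omega powi (3 * k + s) = omega powi s"
proof -
  have "omega powi (3 * k) = 1"
    using omega_cube by (simp add: power_int_mult)
  then show ?thesis by (simp add: power_int_add omega_nonzero)
qed

text \<open>On the Eisenstein lattice the first of the three maps below is multiplication by an element of
  norm \<open>3\<close>, whose image is the sublattice \<open>m \<equiv> n\<close> modulo \<open>3\<close>.  The second is this map followed by a
  translation; the third is the negative of the second, chosen because negation preserves the norm,
  so that both nontrivial cosets will produce the same series.\<close>

lemma infsum_int_pairs_mod3:
  fixes F :: "int \<times> int \<Rightarrow> complex"
  assumes F: "F summable_on UNIV"
  defines "g0 \<equiv> \<lambda>(v, u). (u + 2 * v, u - v)"
    and "g1 \<equiv> \<lambda>(v, u). (u + 2 * v + 1, u - v)"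
    and "g2 \<equiv> \<lambda>(v, u). (- (u + 2 * v + 1), - (u - v))"
  shows "infsum F UNIV = infsum (F \<circ> g0) UNIV + infsum (F \<circ> g1) UNIV + infsum (F \<circ> g2) UNIV"
proof -
  have inj: "inj g0" "inj g1" "inj g2"
    by (auto simp: g0_def g1_def g2_def inj_on_def)
  have range0: "range g0 = {(m, n). (m - n) mod 3 = 0}"
  proof -
    have "(m, n) \<in> range g0 \<longleftrightarrow> (m - n) mod 3 = 0" for m n
    proof -
      have "(m, n) \<in> range g0 \<longleftrightarrow> (\<exists>v u. m = u + 2 * v \<and> n = u - v)"
        by (auto simp: g0_def image_iff)
      then show ?thesis by presburger
    qed
    then show ?thesis by auto
  qed
  have range1: "range g1 = {(m, n). (m - n) mod 3 = 1}"
  proof -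
    have "(m, n) \<in> range g1 \<longleftrightarrow> (m - n) mod 3 = 1" for m n
    proof -
      have "(m, n) \<in> range g1 \<longleftrightarrow> (\<exists>v u. m = u + 2 * v + 1 \<and> n = u - v)"
        by (auto simp: g1_def image_iff)
      then show ?thesis by presburger
    qed
    then show ?thesis by auto
  qed
  have range2: "range g2 = {(m, n). (m - n) mod 3 = 2}"
  proof -
    have "(m, n) \<in> range g2 \<longleftrightarrow> (m - n) mod 3 = 2" for m n
    proof -
      have "(m, n) \<in> range g2 \<longleftrightarrow> (\<exists>v u. m = - (u + 2 * v + 1) \<and> n = - (u - v))"
        by (auto simp: g2_def image_iff)
      then show ?thesis by presburger
    qed
    then show ?thesis by auto
  qed
  note range = range0 range1 range2
  have s: "F summable_on A" for A
    using F by (rule summable_on_subset_banach) simp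
  have residues: "x mod 3 = 0 \<or> x mod 3 = 1 \<or> x mod 3 = 2" for x :: int
    by presburger
  then have "UNIV = (range g0 \<union> range g1) \<union> range g2"
    unfolding range by auto
  then have "infsum F UNIV = infsum F ((range g0 \<union> range g1) \<union> range g2)"
    by simp
  also have "\<dots> = infsum F (range g0) + infsum F (range g1) + infsum F (range g2)"
    by (subst infsum_Un_disjoint[OF s s], (auto simp: range)[1], subst infsum_Un_disjoint[OF s s])
       (auto simp: range)
  finally show ?thesis by (simp add: infsum_reindex inj)
qed

lemma norm_form_dilate: "of_int (norm_form (u + 2 * v) (u - v)) / 3 = (of_int (norm_form v u) :: real)"
  by (simp add: power2_eq_square field_simps)

text \<open>Translating by \<open>(1, 0)\<close> after the dilation is translating by \<open>(1/3, 1/3)\<close> before it.  This is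
  where the exponents of \<open>c\<close> come from.\<close>

lemma norm_form_dilate_shift:
  "of_int (norm_form (u + 2 * v + 1) (u - v)) / 3 =
    (of_int u + 1/3 :: real)\<^sup>2 + (of_int u + 1/3) * (of_int v + 1/3) + (of_int v + 1/3)\<^sup>2"
  by (simp add: power2_eq_square field_simps)

text \<open>The weight \<open>z powi (n - m)\<close> equals \<open>1\<close>, \<open>inverse z\<close> and \<open>z\<close> on the three cosets.  Taking \<open>z = 1\<close>
  gives the transformation of \<open>a\<close>, and \<open>z = \<omega>\<close> that of \<open>b\<close>.\<close>

lemma twisted_theta_third:
  assumes "Im \<tau> > 0" "z \<in> {1, omega}"
  shows "(\<Sum>\<^sub>\<infinity>(m, n)\<in>UNIV. z powi (n - m) * qpow (\<tau> / 3) (of_int (norm_form m n))) =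
    cubic_a \<tau> + (z + inverse z) * cubic_c \<tau>"
proof -
  define F where "F = (\<lambda>(m, n). z powi (n - m) * qpow (\<tau> / 3) (of_int (norm_form m n)))"
  have norm_z: "norm z = 1" and z3: "z powi (3 * k + s) = z powi s" for k s
    using assms(2) norm_omega omega_powi_add_multiple by auto
  have sF: "F summable_on UNIV"
    using theta_summable[of "\<tau> / 3" "\<lambda>(m, n). z powi (n - m)"] assms(1)
    by (simp add: F_def norm_power_int norm_z split_beta)
  let ?c = "\<lambda>(m, n). qpow \<tau> ((of_int n + 1/3)\<^sup>2 + (of_int n + 1/3) * (of_int m + 1/3) + (of_int m + 1/3)\<^sup>2)"
  have *: "z powi (- 3 * v) = 1" "z powi (- 1 - 3 * v) = inverse z" "z powi (1 + 3 * v) = z" for v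
    using z3[of "- v" 0] z3[of "- v" "- 1"] z3[of v 1] by (simp_all add: power_int_minus algebra_simps)
  have F0: "F \<circ> (\<lambda>(v, u). (u + 2 * v, u - v)) = (\<lambda>(m, n). qpow \<tau> (of_int (norm_form m n)))"
  proof
    fix p :: "int \<times> int"
    obtain v u where p: "p = (v, u)" by force
    have "(u - v) - (u + 2 * v) = - 3 * v" by simp
    then show "(F \<circ> (\<lambda>(v, u). (u + 2 * v, u - v))) p = (case p of (m, n) \<Rightarrow> qpow \<tau> (of_int (norm_form m n)))"
      unfolding p F_def o_def case_prod_conv qpow_scale norm_form_dilate by (simp only: * mult_1)
  qed
  have F1: "F \<circ> (\<lambda>(v, u). (u + 2 * v + 1, u - v)) = (\<lambda>p. inverse z * ?c p)"
  proof
    fix p :: "int \<times> int"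
    obtain v u where p: "p = (v, u)" by force
    have "(u - v) - (u + 2 * v + 1) = - 1 - 3 * v" by simp
    then show "(F \<circ> (\<lambda>(v, u). (u + 2 * v + 1, u - v))) p = inverse z * ?c p"
      unfolding p F_def o_def case_prod_conv qpow_scale norm_form_dilate_shift by (simp only: *)
  qed
  have F2: "F \<circ> (\<lambda>(v, u). (- (u + 2 * v + 1), - (u - v))) = (\<lambda>p. z * ?c p)"
  proof
    fix p :: "int \<times> int"
    obtain v u where p: "p = (v, u)" by force
    have "- (u - v) - (- (u + 2 * v + 1)) = 1 + 3 * v" by simp
    moreover have "norm_form (- m) (- n) = norm_form m n" for m n by simp
    ultimately show "(F \<circ> (\<lambda>(v, u). (- (u + 2 * v + 1), - (u - v)))) p = z * ?c p"
      unfolding p F_def o_def case_prod_conv qpow_scale by (simp only: * norm_form_dilate_shift)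
  qed
  have "infsum F UNIV = cubic_a \<tau> + inverse z * cubic_c \<tau> + z * cubic_c \<tau>"
    unfolding infsum_int_pairs_mod3[OF sF] F0 F1 F2
    by (simp only: infsum_cmult_right' cubic_a_def cubic_c_def)
  then show ?thesis by (simp add: F_def algebra_simps)
qed

lemma cubic_a_third:
  assumes "Im \<tau> > 0"
  shows "cubic_a (\<tau> / 3) = cubic_a \<tau> + 2 * cubic_c \<tau>"
  using twisted_theta_third[OF assms, of 1] by (simp add: cubic_a_def)

lemma cubic_b_third:
  assumes "Im \<tau> > 0"
  shows "cubic_b (\<tau> / 3) = cubic_a \<tau> - cubic_c \<tau>"
  using twisted_theta_third[OF assms, of omega] by (simp add: cubic_b_def omega_sum)

section \<open>Existence of \<open>q\<close>-expansions\<close>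

text \<open>Group the double series by the value of the norm form: the coefficient of \<open>q\<^sup>N\<close> is the sum of the
  weights over the lattice points of norm \<open>N\<close>.\<close>

lemma theta_has_q_expansion:
  fixes w :: "int \<times> int \<Rightarrow> complex"
  assumes w: "\<And>p. norm (w p) \<le> 1"
  shows "\<exists>\<nu>. has_q_expansion
    (\<lambda>\<tau>. \<Sum>\<^sub>\<infinity>(m, n)\<in>UNIV. w (m, n) * qpow \<tau> (of_int (norm_form m n))) \<nu>"
proof -
  define L where "L = (\<lambda>N::nat. {(m, n). norm_form m n = int N})"
  define \<nu> where "\<nu> = (\<lambda>N. infsum w (L N))"
  have "(\<lambda>N. \<nu> N * qpow \<tau> (of_nat N)) sums
      (\<Sum>\<^sub>\<infinity>(m, n)\<in>UNIV. w (m, n) * qpow \<tau> (of_int (norm_form m n)))"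
    if "Im \<tau> > 0" for \<tau>
  proof -
    define F where "F = (\<lambda>(m, n). w (m, n) * qpow \<tau> (of_int (norm_form m n)))"
    have sF: "F summable_on UNIV"
      unfolding F_def by (rule theta_summable[OF that w])
    have bij: "bij_betw snd (Sigma UNIV L) UNIV"
      by (rule bij_betwI[where g = "\<lambda>(m, n). (nat (norm_form m n), m, n)"])
         (auto simp: L_def norm_form_nonneg)
    have total: "((\<lambda>x. F (snd x)) has_sum infsum F UNIV) (Sigma UNIV L)"
      unfolding has_sum_reindex_bij_betw[OF bij] by (rule has_sum_infsum[OF sF])
    have fibre: "((\<lambda>p. F (snd (N, p))) has_sum \<nu> N * qpow \<tau> (of_nat N)) (L N)" for N
    proof -
      have eq: "F p = w p * qpow \<tau> (of_nat N)" if "p \<in> L N" for p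
      proof -
        obtain m n where p: "p = (m, n)" by force
        have "norm_form m n = int N" using that by (simp add: p L_def)
        then show ?thesis by (simp only: p F_def case_prod_conv of_int_of_nat_eq)
      qed
      have "F summable_on L N"
        using sF by (rule summable_on_subset_banach) simp
      then have "(F has_sum infsum F (L N)) (L N)" by (rule has_sum_infsum)
      also have "infsum F (L N) = \<nu> N * qpow \<tau> (of_nat N)"
        unfolding \<nu>_def infsum_cmult_left'[symmetric] by (rule infsum_cong) (rule eq)
      finally show ?thesis by simp
    qed
    have "((\<lambda>N. \<nu> N * qpow \<tau> (of_nat N)) has_sum infsum F UNIV) UNIV"
      by (rule has_sum_Sigma'[OF total]) (rule fibre)
    then show ?thesis unfolding F_def by (rule has_sum_imp_sums)
  qed
  then show ?thesis unfolding has_q_expansion_def by blast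
qed

lemma cubic_a_has_q_expansion: "\<exists>\<nu>. has_q_expansion cubic_a \<nu>"
  using theta_has_q_expansion[of "\<lambda>_. 1"] by (simp add: cubic_a_def[abs_def])

lemma cubic_b_has_q_expansion: "\<exists>\<nu>. has_q_expansion cubic_b \<nu>"
  using theta_has_q_expansion[of "\<lambda>(m, n). omega powi (n - m)"]
  by (simp add: cubic_b_def[abs_def] norm_power_int norm_omega split_beta)

text \<open>An expansion is valid on the whole upper half-plane, hence also at \<open>\<tau>/2\<close>, where \<open>\<bar>q\<bar>\<close> is
  larger; a power series converges absolutely strictly inside such a radius.\<close>

lemma q_expansion_abs_summable:
  assumes "has_q_expansion f \<nu>" "Im \<tau> > 0"
  shows "summable (\<lambda>n. norm (\<nu> n * qpow \<tau> (of_nat n)))"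
proof -
  have "summable (\<lambda>n. \<nu> n * qpow (\<tau> / 2) 1 ^ n)"
    using assms unfolding has_q_expansion_def qpow_of_nat[symmetric]
    by (auto dest!: spec[of _ "\<tau> / 2"] intro: sums_summable)
  moreover have "norm (qpow \<tau> 1) < norm (qpow (\<tau> / 2) 1)"
    using assms(2) by (simp add: norm_qpow)
  ultimately show ?thesis unfolding qpow_of_nat by (rule powser_insidea)
qed

lemma has_q_expansion_mult:
  assumes f: "has_q_expansion f \<nu>" and g: "has_q_expansion g \<mu>"
  shows "has_q_expansion (\<lambda>\<tau>. f \<tau> * g \<tau>) (\<lambda>n. \<Sum>i\<le>n. \<nu> i * \<mu> (n - i))"
  unfolding has_q_expansion_def
proof (intro allI impI)
  fix \<tau> :: complex assume \<tau>: "Im \<tau> > 0"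
  have "(\<lambda>n. \<Sum>i\<le>n. (\<nu> i * qpow \<tau> (of_nat i)) * (\<mu> (n - i) * qpow \<tau> (of_nat (n - i)))) sums
      ((\<Sum>n. \<nu> n * qpow \<tau> (of_nat n)) * (\<Sum>n. \<mu> n * qpow \<tau> (of_nat n)))"
    by (rule Cauchy_product_sums) (rule q_expansion_abs_summable[OF f \<tau>] q_expansion_abs_summable[OF g \<tau>])+
  also have "(\<Sum>n. \<nu> n * qpow \<tau> (of_nat n)) = f \<tau>"
    using f \<tau> by (simp add: has_q_expansion_def sums_iff)
  also have "(\<Sum>n. \<mu> n * qpow \<tau> (of_nat n)) = g \<tau>"
    using g \<tau> by (simp add: has_q_expansion_def sums_iff)
  also have "(\<lambda>n. \<Sum>i\<le>n. (\<nu> i * qpow \<tau> (of_nat i)) * (\<mu> (n - i) * qpow \<tau> (of_nat (n - i)))) =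
      (\<lambda>n. (\<Sum>i\<le>n. \<nu> i * \<mu> (n - i)) * qpow \<tau> (of_nat n))"
  proof
    fix n :: nat
    have "qpow \<tau> (of_nat i) * qpow \<tau> (of_nat (n - i)) = qpow \<tau> (of_nat n)" if "i \<le> n" for i
      using that by (simp add: of_nat_diff flip: qpow_add)
    then show "(\<Sum>i\<le>n. (\<nu> i * qpow \<tau> (of_nat i)) * (\<mu> (n - i) * qpow \<tau> (of_nat (n - i)))) =
        (\<Sum>i\<le>n. \<nu> i * \<mu> (n - i)) * qpow \<tau> (of_nat n)"
      unfolding sum_distrib_right by (intro sum.cong) (auto simp: algebra_simps)
  qed
  finally show "(\<lambda>n. (\<Sum>i\<le>n. \<nu> i * \<mu> (n - i)) * qpow \<tau> (of_nat n)) sums (f \<tau> * g \<tau>)" .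
qed

lemma has_q_expansion_const: "has_q_expansion (\<lambda>_. c) (\<lambda>n. if n = 0 then c else 0)"
proof -
  have "(\<lambda>n. (if n = 0 then c else 0) * qpow \<tau> (of_nat n)) = (\<lambda>n. if n = 0 then c else 0)" for \<tau>
    by (auto simp: qpow_of_nat)
  then show ?thesis
    using sums_single[of 0 "\<lambda>_. c"] by (simp add: has_q_expansion_def)
qed

lemma has_q_expansion_power:
  assumes "\<exists>\<nu>. has_q_expansion f \<nu>"
  shows "\<exists>\<nu>. has_q_expansion (\<lambda>\<tau>. f \<tau> ^ k) \<nu>"
proof (induction k)
  case 0
  show ?case using has_q_expansion_const[of 1] by auto
next
  case (Suc k)
  with assms show ?case by (auto dest: has_q_expansion_mult)
qed

lemma has_q_expansion_sum:
  assumes "\<And>k. k \<in> A \<Longrightarrow> \<exists>\<nu>. has_q_expansion (f k) \<nu>"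
  shows "\<exists>\<nu>. has_q_expansion (\<lambda>\<tau>. \<Sum>k\<in>A. f k \<tau>) \<nu>"
proof -
  obtain \<nu> where \<nu>: "\<And>k. k \<in> A \<Longrightarrow> has_q_expansion (f k) (\<nu> k)"
    using assms by metis
  have "has_q_expansion (\<lambda>\<tau>. \<Sum>k\<in>A. f k \<tau>) (\<lambda>n. \<Sum>k\<in>A. \<nu> k n)"
    using \<nu> by (auto simp: has_q_expansion_def sum_distrib_right intro!: sums_sum)
  then show ?thesis by blast
qed

lemma homogeneous_polynomial_has_q_expansion:
  "\<exists>\<nu>. has_q_expansion (\<lambda>\<tau>. \<Sum>n = 0..d. \<alpha> n * cubic_a \<tau> ^ (d - n) * cubic_b \<tau> ^ n) \<nu>"
proof (rule has_q_expansion_sum)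
  fix n
  obtain \<mu> where "has_q_expansion (\<lambda>\<tau>. cubic_a \<tau> ^ (d - n)) \<mu>"
    using has_q_expansion_power[OF cubic_a_has_q_expansion] by blast
  moreover obtain \<kappa> where "has_q_expansion (\<lambda>\<tau>. cubic_b \<tau> ^ n) \<kappa>"
    using has_q_expansion_power[OF cubic_b_has_q_expansion] by blast
  ultimately show "\<exists>\<nu>. has_q_expansion (\<lambda>\<tau>. \<alpha> n * cubic_a \<tau> ^ (d - n) * cubic_b \<tau> ^ n) \<nu>"
    using has_q_expansion_mult has_q_expansion_const by meson
qed

lemma pi_op_eq:
  assumes "has_q_expansion f \<nu>" "Im \<tau> > 0"
  shows "pi_op \<nu> \<tau> = f (\<tau> / 3)"
proof -
  have "(\<lambda>n. \<nu> n * qpow (\<tau> / 3) (of_nat n)) sums f (\<tau> / 3)"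
    using assms by (simp add: has_q_expansion_def)
  then show ?thesis by (simp add: pi_op_def qpow_scale sums_iff)
qed

section \<open>The matrix of the substitution\<close>

text \<open>The coefficient of \<open>a\<^sup>r c\<^sup>m\<^sup>+\<^sup>n\<^sup>-\<^sup>r\<close> in \<open>(a + 2c)\<^sup>m (a - c)\<^sup>n\<close>.  The sign is written with exponent
  \<open>n + (r - k)\<close>, which has the parity of \<open>n - (r - k)\<close> and avoids truncation when \<open>r - k\<close> exceeds
  \<open>n\<close>; the guard \<open>k \<le> r\<close> keeps the other truncated difference from producing \<open>n choose 0\<close>.\<close>

definition subst_coeff :: "nat \<Rightarrow> nat \<Rightarrow> nat \<Rightarrow> int" where
  "subst_coeff m n r = (\<Sum>k = 0..m. if k \<le> r
     then 2 ^ (m - k) * (- 1) ^ (n + (r - k)) * int (m choose k) * int (n choose (r - k)) else 0)"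

lemma subst_coeff_expansion:
  fixes a c :: complex
  shows "(a + 2 * c) ^ m * (a - c) ^ n =
    (\<Sum>r = 0..m + n. of_int (subst_coeff m n r) * a ^ r * c ^ (m + n - r))"
proof -
  define s where "s = (\<lambda>k j. of_int (2 ^ (m - k) * (- 1) ^ (n + j) * int (m choose k) * int (n choose j)) :: complex)"
  have "(a + 2 * c) ^ m = (\<Sum>k = 0..m. of_nat (m choose k) * a ^ k * (2 * c) ^ (m - k))"
    by (simp add: binomial_ring atLeast0AtMost)
  moreover have "(a - c) ^ n = (\<Sum>j = 0..n. of_nat (n choose j) * a ^ j * (- c) ^ (n - j))"
    using binomial_ring[of a "- c" n] by (simp add: atLeast0AtMost)
  ultimately have "(a + 2 * c) ^ m * (a - c) ^ n = (\<Sum>k = 0..m. \<Sum>j = 0..n.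
      (of_nat (m choose k) * a ^ k * (2 * c) ^ (m - k)) * (of_nat (n choose j) * a ^ j * (- c) ^ (n - j)))"
    by (simp only: sum_product)
  also have "\<dots> = (\<Sum>k = 0..m. \<Sum>j = 0..n. s k j * a ^ (k + j) * c ^ (m + n - (k + j)))"
  proof (intro sum.cong refl)
    fix k j assume "k \<in> {0..m}" "j \<in> {0..n}"
    then have kj: "k \<le> m" "j \<le> n" by auto
    have "(- 1 :: complex) ^ (n - j) = (- 1) ^ (n + j)"
      using kj by (simp add: minus_one_power_iff)
    then have "(- c) ^ (n - j) = (- 1) ^ (n + j) * c ^ (n - j)"
      by (subst power_minus) simp
    moreover have "c ^ (m + n - (k + j)) = c ^ (m - k) * c ^ (n - j)"
      using kj by (simp flip: power_add)
    ultimately show "(of_nat (m choose k) * a ^ k * (2 * c) ^ (m - k)) * (of_nat (n choose j) * a ^ j * (- c) ^ (n - j)) =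
        s k j * a ^ (k + j) * c ^ (m + n - (k + j))"
      by (simp add: s_def power_add power_mult_distrib mult_ac)
  qed
  \<comment> \<open>Reindex by \<open>r = k + j\<close> and let \<open>r\<close> run over the full range, independent of \<open>k\<close>, so that the
    two sums can be exchanged; the added terms vanish because \<open>n choose j = 0\<close> for \<open>j > n\<close>.\<close>
  also have "\<dots> = (\<Sum>k = 0..m. \<Sum>r = 0..m + n. (if k \<le> r then s k (r - k) else 0) * a ^ r * c ^ (m + n - r))"
  proof (rule sum.cong[OF refl])
    fix k assume "k \<in> {0..m}"
    then have k: "k \<le> m" by auto
    let ?h = "\<lambda>r. s k (r - k) * a ^ r * c ^ (m + n - r)"
    have "(\<Sum>j = 0..n. s k j * a ^ (k + j) * c ^ (m + n - (k + j))) = (\<Sum>r = 0 + k..n + k. ?h r)"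
      unfolding sum.shift_bounds_cl_nat_ivl by (simp add: add_ac)
    also have "\<dots> = (\<Sum>r = 0..m + n. (if k \<le> r then s k (r - k) else 0) * a ^ r * c ^ (m + n - r))"
      by (rule sum.mono_neutral_cong_left) (use k in \<open>auto simp: s_def binomial_eq_0_iff\<close>)
    finally show "(\<Sum>j = 0..n. s k j * a ^ (k + j) * c ^ (m + n - (k + j))) =
        (\<Sum>r = 0..m + n. (if k \<le> r then s k (r - k) else 0) * a ^ r * c ^ (m + n - r))" .
  qed
  also have "\<dots> = (\<Sum>r = 0..m + n. of_int (subst_coeff m n r) * a ^ r * c ^ (m + n - r))"
    by (subst sum.swap) (simp add: subst_coeff_def s_def sum_distrib_right if_distrib[of of_int] cong: if_cong)
  finally show ?thesis .
qed

lemma minus_one_powi_diff: "(- 1 :: complex) powi (int n - int j) = (- 1) ^ (n + j)"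
  by (simp add: power_int_diff power_add) (simp add: minus_one_power_iff)

lemma binom_of_nat: "binom N (int i) = N choose i"
  by (simp add: binom_def)

lemma subst_coeff_eq_binom:
  "complex_of_int (subst_coeff m n r) =
    (\<Sum>k = 0..m. 2 ^ (m - k) * (- 1) powi (int n - (int r - int k))
      * of_nat (binom m (int k)) * of_nat (binom n (int r - int k)))"
proof -
  have "of_int (if k \<le> r then 2 ^ (m - k) * (- 1) ^ (n + (r - k)) * int (m choose k) * int (n choose (r - k)) else 0) =
      2 ^ (m - k) * (- 1 :: complex) powi (int n - (int r - int k))
      * of_nat (binom m (int k)) * of_nat (binom n (int r - int k))" for k
  proof (cases "k \<le> r")
    case True
    then have "int r - int k = int (r - k)" by simp
    then show ?thesis using True by (simp only: binom_of_nat minus_one_powi_diff) simp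
  qed (simp add: binom_def)
  then show ?thesis by (simp only: subst_coeff_def of_int_sum)
qed

lemma hyp2F1_terminating:
  "hyp2F1 (- of_nat m) B C z =
    (\<Sum>k = 0..m. pochhammer (- of_nat m) k * pochhammer B k / (pochhammer C k * fact k) * z ^ k)"
  unfolding hyp2F1_def by (rule suminf_finite) (auto simp: pochhammer_of_nat_eq_0_lemma)

lemma pochhammer_minus_of_nat_complex:
  assumes "k \<le> m"
  shows "pochhammer (- of_nat m :: complex) k = (- 1) ^ k * fact m / fact (m - k)"
proof -
  have "pochhammer (of_nat m - of_nat k + 1 :: complex) k * fact (m - k) = fact m"
    using pochhammer_product'[of "1 :: complex" "m - k" k] assms
    by (simp add: pochhammer_fact of_nat_diff algebra_simps)
  then show ?thesis by (simp add: pochhammer_minus field_simps)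
qed

text \<open>The identity holds term by term.  For \<open>k \<le> min m r\<close> all Pochhammer symbols are quotients of
  factorials, and
  \<open>(n choose r) r! (n - r)! / ((r - k)! (n - r + k)!) = (n choose (r - k))\<close>.  For \<open>r < k \<le> m\<close> both
  sides vanish, the right one through the factor \<open>pochhammer (- r) k\<close>.  The hypothesis \<open>r \<le> n\<close> makes
  the lower parameter \<open>n - r + 1\<close> a positive integer, so no denominator is zero.\<close>

lemma subst_coeff_eq_hyp2F1:
  assumes "r \<le> n"
  shows "complex_of_int (subst_coeff m n r) =
    2 ^ m * (- 1) powi (int n - int r) * of_nat (binom n (int r))
      * hyp2F1 (- of_nat m) (- of_nat r) (of_nat n - of_nat r + 1) (- 1 / 2)"
proof -
  have term_eq: "of_int (if k \<le> r then 2 ^ (m - k) * (- 1) ^ (n + (r - k)) * int (m choose k) * int (n choose (r - k)) else 0) =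
     2 ^ m * (- 1) ^ (n + r) * of_nat (n choose r) *
      (pochhammer (- of_nat m) k * pochhammer (- of_nat r) k /
        (pochhammer (of_nat n - of_nat r + 1) k * fact k) * (- 1 / 2 :: complex) ^ k)"
    if "k \<in> {0..m}" for k
  proof (cases "k \<le> r")
    case True
    have k: "k \<le> m" using that by simp
    have poch: "pochhammer (of_nat n - of_nat r + 1 :: complex) k = fact (n - r + k) / fact (n - r)"
      using pochhammer_product'[of "1 :: complex" "n - r" k] assms
      by (simp add: of_nat_diff nonzero_eq_divide_eq algebra_simps flip: pochhammer_fact)
    have ch: "of_nat (m choose k) = (fact m / (fact k * fact (m - k)) :: complex)"
      "of_nat (n choose r) = (fact n / (fact r * fact (n - r)) :: complex)"
      "of_nat (n choose (r - k)) = (fact n / (fact (r - k) * fact (n - r + k)) :: complex)"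
      using k True assms binomial_fact[of "r - k" n, where 'a = complex] by (simp_all add: binomial_fact)
    have sgn: "(- 1 :: complex) ^ (n + (r - k)) = (- 1) ^ (n + r) * (- 1) ^ k"
      using True by (simp add: minus_one_power_iff)
    have pw: "(2 :: complex) ^ m = 2 ^ (m - k) * 2 ^ k"
      using k by (simp flip: power_add)
    have sq: "(- 1 :: complex) ^ k * (- 1) ^ k = 1" by (simp flip: power_mult_distrib)
    have half: "(- 1 / 2 :: complex) ^ k = (- 1) ^ k / 2 ^ k" by (simp only: power_divide)
    have "2 ^ (m - k) * (- 1) ^ (n + (r - k)) * of_nat (m choose k) * of_nat (n choose (r - k)) =
     2 ^ m * (- 1) ^ (n + r) * of_nat (n choose r) *
      (pochhammer (- of_nat m) k * pochhammer (- of_nat r) k /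
        (pochhammer (of_nat n - of_nat r + 1) k * fact k) * (- 1 / 2 :: complex) ^ k)"
      unfolding pochhammer_minus_of_nat_complex[OF k] pochhammer_minus_of_nat_complex[OF True]
        poch ch sgn pw half using sq by (simp add: field_simps)
    then show ?thesis using True by simp
  qed (simp add: pochhammer_of_nat_eq_0_lemma)
  show ?thesis
    unfolding hyp2F1_terminating minus_one_powi_diff binom_of_nat subst_coeff_def of_int_sum sum_distrib_left
    by (rule sum.cong[OF refl term_eq])
qed

theorem theorem3p4:
  fixes d :: nat
  assumes "d > 0"
  shows "\<exists>B :: int mat. B \<in> carrier_mat (d + 1) (d + 1) \<and>
    (\<forall>(\<alpha> :: nat \<Rightarrow> complex) (\<beta> :: nat \<Rightarrow> complex) (f :: complex \<Rightarrow> complex).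
       f = (\<lambda>\<tau>. \<Sum>n = 0..d. \<alpha> n * cubic_a \<tau> ^ (d - n) * cubic_b \<tau> ^ n) \<longrightarrow>
       map_mat complex_of_int B *\<^sub>v Matrix.vec (d + 1) \<alpha> = Matrix.vec (d + 1) \<beta> \<longrightarrow>
       (\<exists>\<nu>. has_q_expansion f \<nu>) \<and>
       (\<forall>\<nu>. has_q_expansion f \<nu> \<longrightarrow>
          (\<forall>\<tau>. Im \<tau> > 0 \<longrightarrow>
             pi_op \<nu> \<tau> = f (\<tau> / 3) \<and>
             f (\<tau> / 3) = (\<Sum>n = 0..d. \<beta> n * cubic_a \<tau> ^ n * cubic_c \<tau> ^ (d - n))))) \<and>
    (\<forall>r \<le> d. \<forall>n \<le> d.
       complex_of_int (B $$ (r, n)) =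
         (\<Sum>k = 0..d - n. 2 ^ ((d - n) - k) * (-1) powi (int n - (int r - int k))
            * of_nat (binom (d - n) (int k)) * of_nat (binom n (int r - int k)))) \<and>
    (\<forall>r \<le> d. \<forall>n \<le> d. r \<le> n \<longrightarrow>
       complex_of_int (B $$ (r, n)) =
         2 ^ (d - n) * (-1) powi (int n - int r) * of_nat (binom n (int r))
           * hyp2F1 (of_nat n - of_nat d) (- of_nat r) (of_nat n - of_nat r + 1) (- 1 / 2))"
proof -
  define B where "B = mat (d + 1) (d + 1) (\<lambda>(r, n). subst_coeff (d - n) n r)"
  have entry: "B $$ (r, n) = subst_coeff (d - n) n r" if "r \<le> d" "n \<le> d" for r n
    using that by (simp add: B_def)
  have transform: "f (\<tau> / 3) = (\<Sum>r = 0..d. \<beta> r * cubic_a \<tau> ^ r * cubic_c \<tau> ^ (d - r))"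
    if f: "f = (\<lambda>\<tau>. \<Sum>n = 0..d. \<alpha> n * cubic_a \<tau> ^ (d - n) * cubic_b \<tau> ^ n)"
      and B\<alpha>: "map_mat complex_of_int B *\<^sub>v Matrix.vec (d + 1) \<alpha> = Matrix.vec (d + 1) \<beta>"
      and \<tau>: "Im \<tau> > 0" for \<alpha> \<beta> f \<tau>
  proof -
    have \<beta>: "\<beta> r = (\<Sum>n = 0..d. of_int (subst_coeff (d - n) n r) * \<alpha> n)" if r: "r \<le> d" for r
    proof -
      have "\<beta> r = (map_mat complex_of_int B *\<^sub>v Matrix.vec (d + 1) \<alpha>) $ r"
        unfolding B\<alpha> using r by simp
      also have "\<dots> = (\<Sum>n = 0..d. of_int (subst_coeff (d - n) n r) * \<alpha> n)"
        using r by (simp add: B_def scalar_prod_def atLeastLessThanSuc_atLeastAtMost)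
      finally show ?thesis .
    qed
    have "f (\<tau> / 3) = (\<Sum>n = 0..d. \<alpha> n * ((cubic_a \<tau> + 2 * cubic_c \<tau>) ^ (d - n) * (cubic_a \<tau> - cubic_c \<tau>) ^ n))"
      by (simp add: f cubic_a_third[OF \<tau>] cubic_b_third[OF \<tau>] mult.assoc)
    also have "\<dots> = (\<Sum>n = 0..d. \<Sum>r = 0..d.
        \<alpha> n * (of_int (subst_coeff (d - n) n r) * cubic_a \<tau> ^ r * cubic_c \<tau> ^ (d - r)))"
      by (intro sum.cong refl) (simp add: subst_coeff_expansion sum_distrib_left)
    also have "\<dots> = (\<Sum>r = 0..d. \<beta> r * cubic_a \<tau> ^ r * cubic_c \<tau> ^ (d - r))"
      by (subst sum.swap) (simp add: \<beta> sum_distrib_left sum_distrib_right mult_ac)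
    finally show ?thesis .
  qed
  have hyp: "complex_of_int (B $$ (r, n)) =
      2 ^ (d - n) * (-1) powi (int n - int r) * of_nat (binom n (int r))
        * hyp2F1 (of_nat n - of_nat d) (- of_nat r) (of_nat n - of_nat r + 1) (- 1 / 2)"
    if "r \<le> d" "n \<le> d" "r \<le> n" for r n
  proof -
    have "(of_nat n - of_nat d :: complex) = - of_nat (d - n)"
      using that by (simp add: of_nat_diff)
    then show ?thesis
      by (simp only: entry[OF that(1,2)] subst_coeff_eq_hyp2F1[OF that(3)])
  qed
  show ?thesis
  proof (intro exI[of _ B] conjI allI impI)
    show "B \<in> carrier_mat (d + 1) (d + 1)" by (simp add: B_def)
  next
    fix \<alpha> :: "nat \<Rightarrow> complex" and f :: "complex \<Rightarrow> complex"
    assume "f = (\<lambda>\<tau>. \<Sum>n = 0..d. \<alpha> n * cubic_a \<tau> ^ (d - n) * cubic_b \<tau> ^ n)"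
    then show "\<exists>\<nu>. has_q_expansion f \<nu>"
      using homogeneous_polynomial_has_q_expansion by simp
  next
    fix f :: "complex \<Rightarrow> complex" and \<nu> \<tau>
    assume "has_q_expansion f \<nu>" "Im \<tau> > 0"
    then show "pi_op \<nu> \<tau> = f (\<tau> / 3)" by (rule pi_op_eq)
  qed (rule transform hyp | assumption | simp only: entry subst_coeff_eq_binom)+
qed

end
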